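(* Let $F$ be a field with $\operatorname{char}(F)\neq 2$. Then there does not exist a sums-of-squares formula of type $[11,15,17]$ over $F$.
   Context: A sums-of-squares formula of type $[r,s,n]$ over a field $F$ is an identity $$(x_1^2+\cdots+x_r^2)(y_1^2+\cdots+y_s^2)=z_1^2+\cdots+z_n^2$$ in the polynomial ring $F[x_1,\ldots,x_r,y_1,\ldots,y_s]$, where each $z_i$ is a bilinear expression in the $x$'s and $y$'s with coefficients in $F$ (i.e. an $F$-linear combination of the products $x_jy_k$). *)

theory Defs
  imports "HOL-Library.Poly_Mapping"
begin

text \<open>
  Multivariate polynomials are finitely supported coefficient functions on monomials, and monomials
  are finitely supported exponent functions on variables; the ring operations are the convolution
  operations of \<^theory>\<open>HOL-Library.Poly_Mapping\<close>. There are infinitely many variables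
  \<open>VX j\<close>, \<open>VY k\<close>, but a formula of type \<open>[r, s, n]\<close> only involves
  \<open>VX 1, \<dots>, VX r, VY 1, \<dots>, VY s\<close> and so lives in
  \<open>F[x\<^sub>1, \<dots>, x\<^sub>r, y\<^sub>1, \<dots>, y\<^sub>s]\<close>.
\<close>

datatype sos_var = VX nat | VY nat

type_synonym 'a sos_poly = "(sos_var \<Rightarrow>\<^sub>0 nat) \<Rightarrow>\<^sub>0 'a"

definition pconst :: "'a::zero \<Rightarrow> 'a sos_poly" where
  "pconst c = Poly_Mapping.single 0 c"

definition pvar :: "sos_var \<Rightarrow> 'a::zero_neq_one sos_poly" where
  "pvar v = Poly_Mapping.single (Poly_Mapping.single v 1) 1"

definition bilinear_form :: "nat \<Rightarrow> nat \<Rightarrow> 'a::field sos_poly \<Rightarrow> bool" where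
  "bilinear_form r s z \<longleftrightarrow>
     (\<exists>c :: nat \<Rightarrow> nat \<Rightarrow> 'a.
        z = (\<Sum>j = 1..r. \<Sum>k = 1..s. pconst (c j k) * (pvar (VX j) * pvar (VY k))))"

definition sos_formula :: "nat \<Rightarrow> nat \<Rightarrow> nat \<Rightarrow> (nat \<Rightarrow> 'a::field sos_poly) \<Rightarrow> bool" where
  "sos_formula r s n z \<longleftrightarrow>
     (\<forall>i\<in>{1..n}. bilinear_form r s (z i)) \<and>
     (\<Sum>j = 1..r. (pvar (VX j))\<^sup>2) * (\<Sum>k = 1..s. (pvar (VY k))\<^sup>2) = (\<Sum>i = 1..n. (z i)\<^sup>2)"

end

theory Submission
  imports Defs "HOL-Analysis.Determinants"
begin

text \<open>
  Write the formula as \<open>z = (\<Sum>\<^sub>i x\<^sub>i A\<^sub>i) y\<close> with \<open>17 \<times> 15\<close> matrices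
  \<open>A\<^sub>0, \<dots>, A\<^sub>1\<^sub>0\<close>. Compressing to the image of the isometry \<open>A\<^sub>1\<^sub>0\<close> yields ten skew
  \<open>15 \<times> 15\<close> matrices \<open>B\<^sub>i\<close> which satisfy the Clifford relations up to terms
  \<open>h a\<^sub>i a\<^sub>j\<^sup>T + k b\<^sub>i b\<^sub>j\<^sup>T\<close> coming from the two-dimensional complement of the image. As skew
  matrices of odd size are singular, \<open>a\<^sub>i\<close> and \<open>b\<^sub>i\<close> are proportional vectors in the kernel of
  \<open>B\<^sub>i\<close>. The same holds for \<open>B\<^sub>i + B\<^sub>j\<close>, which forces \<open>a\<^sub>i = \<alpha> c\<^sub>i\<close> and
  \<open>b\<^sub>i = \<beta> c\<^sub>i\<close> with \<open>\<alpha>, \<beta>\<close> independent of \<open>i\<close>. Bordering \<open>B\<^sub>i\<close> by \<open>c\<^sub>i\<close>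
  gives ten anticommuting \<open>16 \<times> 16\<close> matrices with square \<open>- 1\<close>; their \<open>2\<^sup>1\<^sup>0\<close> monomials are
  linearly independent in a space of dimension \<open>2\<^sup>8\<close>, a contradiction.
\<close>

section \<open>Skew matrices with a defect of rank two\<close>

definition vdot :: "'a::comm_ring_1 ^ 'n \<Rightarrow> 'a ^ 'n \<Rightarrow> 'a" where
  "vdot x y = (\<Sum>i\<in>UNIV. x $ i * y $ i)"

lemma vdot_commute: "vdot x y = vdot y x"
  by (simp add: vdot_def mult.commute)

lemma vdot_add_left [simp]: "vdot (x + y) z = vdot x z + vdot y z"
  and vdot_add_right [simp]: "vdot z (x + y) = vdot z x + vdot z y"
  and vdot_minus_left [simp]: "vdot (- x) z = - vdot x z"
  and vdot_minus_right [simp]: "vdot z (- x) = - vdot z x"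
  and vdot_diff_left [simp]: "vdot (x - y) z = vdot x z - vdot y z"
  and vdot_diff_right [simp]: "vdot z (x - y) = vdot z x - vdot z y"
  and vdot_scale_left [simp]: "vdot (c *s x) z = c * vdot x z"
  and vdot_scale_right [simp]: "vdot z (c *s x) = c * vdot z x"
  and vdot_zero_left [simp]: "vdot 0 z = 0"
  and vdot_zero_right [simp]: "vdot z 0 = 0"
  by (simp_all add: vdot_def algebra_simps sum.distrib sum_distrib_left sum_negf sum_subtractf)

lemma vdot_axis [simp]: "vdot x (axis i 1) = x $ i" "vdot (axis i 1) x = x $ i"
proof -
  show "vdot x (axis i 1) = x $ i"
  proof -
    have "x $ j * axis i 1 $ j = (if j = i then x $ j else 0)" for j
      by (simp add: axis_def)
    then show ?thesis by (simp add: vdot_def)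
  qed
  then show "vdot (axis i 1) x = x $ i"
    by (simp add: vdot_commute)
qed

lemma matrix_vector_axis: "((A :: 'a::comm_ring_1 ^ 'n ^ 'm) *v axis q 1) $ p = A $ p $ q"
  using vdot_axis(1)[of "A $ p" q] by (simp add: matrix_vector_mult_def vdot_def)

lemma vdot_sum_right: "vdot z (sum f I) = (\<Sum>i\<in>I. vdot z (f i))"
  by (induction I rule: infinite_finite_induct) simp_all

lemma vdot_matrix_left: "vdot (A *v x) y = vdot x (transpose A *v y)"
  unfolding vdot_def matrix_vector_mult_def transpose_def
  by (simp add: sum_distrib_left sum_distrib_right, subst sum.swap) (simp add: ac_simps)

lemma matrix_vector_mult_minus_left: "(- A) *v x = - (A *v (x :: 'a::ring_1 ^ 'n))"
  by (simp add: vec_eq_iff matrix_vector_mult_def sum_negf)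

text \<open>Negation multiplies the determinant by -1 once for each of the oddly many rows, while
  transposition preserves it; hence \<open>2 * det B = 0\<close>.\<close>

lemma det_skew_odd:
  fixes B :: "'a::field ^ 'm ^ 'm"
  assumes "(2::'a) \<noteq> 0" "odd CARD('m)" "transpose B = - B"
  shows "det B = 0"
proof -
  have "det (- B) = det (\<chi> i. (- 1) *s (B $ i))"
    by (rule arg_cong[where f = det]) (simp add: vec_eq_iff)
  also have "\<dots> = - det B"
    using assms(2) by (subst det_rows_mul) simp
  finally have "det B = - det B"
    using det_transpose[of B] assms(3) by simp
  then have "2 * det B = 0" by (simp add: algebra_simps eq_neg_iff_add_eq_0)
  with assms(1) show ?thesis by simp
qed

lemma skew_odd_kernel:
  fixes B :: "'a::field ^ 'm ^ 'm"
  assumes "(2::'a) \<noteq> 0" "odd CARD('m)" "transpose B = - B"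
  obtains v where "v \<noteq> 0" "B *v v = 0"
proof -
  have "\<not> invertible B"
    using det_skew_odd[OF assms] by (simp add: invertible_det_nz)
  then show ?thesis
    using that by (auto simp: invertible_left_inverse matrix_left_invertible_ker)
qed

text \<open>Cramer's rule for the nonzero minor in columns \<open>i\<close> and \<open>j\<close>;
  the vectors found are supported on these two coordinates.\<close>

lemma dual_vectors:
  fixes a b :: "'a::field ^ 'm"
  assumes "a $ i * b $ j \<noteq> a $ j * b $ i"
  obtains x y where "vdot a x = 1" "vdot b x = 0" "vdot a y = 0" "vdot b y = 1"
proof
  let ?d = "a $ i * b $ j - a $ j * b $ i"
  show "vdot a (inverse ?d *s (b $ j *s axis i 1 - b $ i *s axis j 1)) = 1"
    using assms by (simp add: mult.commute)
  show "vdot b (inverse ?d *s (b $ j *s axis i 1 - b $ i *s axis j 1)) = 0"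
    by (simp add: field_simps)
  show "vdot a (inverse ?d *s (a $ i *s axis j 1 - a $ j *s axis i 1)) = 0"
    by (simp add: field_simps)
  show "vdot b (inverse ?d *s (a $ i *s axis j 1 - a $ j *s axis i 1)) = 1"
    using assms by (simp add: mult.commute)
qed

text \<open>The scalar \<open>q\<close> stays general because the results are applied with
  \<open>q = 1\<close> to a single generator and with \<open>q = 2\<close> to a sum of two.\<close>

context
  fixes B :: "'a::field ^ 'm ^ 'm" and a b :: "'a ^ 'm" and q h k :: 'a
  assumes two: "(2::'a) \<noteq> 0"
    and odd: "odd CARD('m)"
    and skew: "transpose B = - B"
    and q: "q \<noteq> 0" and h: "h \<noteq> 0" and k: "k \<noteq> 0"
    and square: "\<And>x. B *v (B *v x) = (h * vdot a x) *s a + (k * vdot b x) *s b - q *s x"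
begin

lemma vdot_skew: "vdot (B *v x) y = - vdot x (B *v y)"
  by (simp add: vdot_matrix_left skew matrix_vector_mult_minus_left)

text \<open>\<open>B\<close> commutes with its own square, hence with the defect h a a^T + k b b^T;
  the proof computes the cube of \<open>B\<close> in two ways.\<close>

lemma commutes_with_defect:
  "(h * vdot a (B *v x)) *s a + (k * vdot b (B *v x)) *s b =
   (h * vdot a x) *s (B *v a) + (k * vdot b x) *s (B *v b)"
proof -
  have "B *v (B *v (B *v x)) =
      (h * vdot a x) *s (B *v a) + (k * vdot b x) *s (B *v b) - q *s (B *v x)"
    by (subst square)
       (simp add: matrix_vector_mult_diff_distrib matrix_vector_right_distrib vec.scale)
  with square[of "B *v x"] show ?thesis by simp
qed

text \<open>Were \<^term>\<open>a\<close> and \<^term>\<open>b\<close> independent, \<^term>\<open>B\<close> would kill both, and adding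
  \<open>a b\<^sup>T - b a\<^sup>T\<close> to it would give a nonsingular skew matrix of odd size.\<close>

lemma defect_rank_one: "a $ i * b $ j = a $ j * b $ i"
proof (rule ccontr)
  assume "\<not> ?thesis"
  then obtain x y where
    x: "vdot a x = 1" "vdot b x = 0" and y: "vdot a y = 0" "vdot b y = 1"
    by (rule dual_vectors)
  define \<beta> where "\<beta> = vdot (B *v a) y"
  define \<gamma> where "\<gamma> = vdot (B *v b) x"
  have sw: "vdot a (B *v z) = - vdot (B *v a) z" "vdot b (B *v z) = - vdot (B *v b) z" for z
    by (simp_all add: vdot_skew)
  \<comment> \<open>Evaluating the commutation relation at the dual vectors \<open>x\<close> and
    \<open>y\<close> writes \<open>B *v a\<close> and \<open>B *v b\<close> as combinations of
    \<open>a\<close> and \<open>b\<close>.\<close>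
  have Bx: "h *s (B *v a) = - (h * vdot (B *v a) x) *s a - (k * \<gamma>) *s b"
    using commutes_with_defect[of x] x by (simp add: sw \<gamma>_def)
  have By: "k *s (B *v b) = - (h * \<beta>) *s a - (k * vdot (B *v b) y) *s b"
    using commutes_with_defect[of y] y by (simp add: sw \<beta>_def)
  \<comment> \<open>Pairing with \<open>x\<close> shows that the diagonal coefficient is its own
    negative. The same happens for \<open>b\<close> and \<open>y\<close>, so \<open>B\<close>
    exchanges the lines of \<open>a\<close> and \<open>b\<close> up to factors \<beta> and \<gamma>,
    which by \<open>rel\<close> vanish together.\<close>
  have "h * vdot (B *v a) x = - (h * vdot (B *v a) x)"
    using arg_cong[OF Bx, of "\<lambda>v. vdot v x"] x by simp
  then have "2 * (h * vdot (B *v a) x) = 0" by (simp add: eq_neg_iff_add_eq_0)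
  then have ax: "vdot (B *v a) x = 0" using two h by simp
  have "k * vdot (B *v b) y = - (k * vdot (B *v b) y)"
    using arg_cong[OF By, of "\<lambda>v. vdot v y"] y by simp
  then have "2 * (k * vdot (B *v b) y) = 0" by (simp add: eq_neg_iff_add_eq_0)
  then have by': "vdot (B *v b) y = 0" using two k by simp
  have rel: "h * \<beta> = - (k * \<gamma>)"
    using arg_cong[OF Bx, of "\<lambda>v. vdot v y"] y by (simp add: \<beta>_def)
  have "h *s (B *v a) = h *s (\<beta> *s b)"
    using Bx ax rel by (simp add: vector_smult_assoc)
  then have Ba: "B *v a = \<beta> *s b" using h by (simp only: vec.scale_cancel_left) simp
  have "k *s (B *v b) = k *s (\<gamma> *s a)"
    using By by' rel by (simp add: vector_smult_assoc)
  then have Bb: "B *v b = \<gamma> *s a" using k by (simp only: vec.scale_cancel_left) simp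

  \<comment> \<open>A kernel vector lies in the span of \<open>a\<close> and \<open>b\<close>.
    Applying \<open>B\<close> to it gives a relation between the independent vectors
    \<open>a\<close> and \<open>b\<close>, which forces \<beta> or \<gamma> to be zero.\<close>
  obtain v where v: "v \<noteq> 0" "B *v v = 0"
    using skew_odd_kernel[OF two odd skew] by blast
  have qv: "q *s v = (h * vdot a v) *s a + (k * vdot b v) *s b"
    using square[of v] v by simp
  have "B *v (q *s v) = (h * vdot a v * \<beta>) *s b + (k * vdot b v * \<gamma>) *s a"
    unfolding qv by (simp add: matrix_vector_right_distrib vec.scale Ba Bb)
  then have z: "(h * vdot a v * \<beta>) *s b + (k * vdot b v * \<gamma>) *s a = 0"
    by (simp add: vec.scale v)
  have "h * vdot a v * \<beta> = 0" using arg_cong[OF z, of "\<lambda>w. vdot w y"] y by simp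
  moreover have "k * vdot b v * \<gamma> = 0" using arg_cong[OF z, of "\<lambda>w. vdot w x"] x by simp
  moreover have "vdot a v \<noteq> 0 \<or> vdot b v \<noteq> 0"
    using qv q v by (auto simp: vec.scale_eq_0_iff)
  ultimately have "\<beta> = 0 \<or> \<gamma> = 0" using h k by auto
  then have "\<beta> = 0" "\<gamma> = 0" using rel h k by auto
  then have B0: "B *v a = 0" "B *v b = 0" using Ba Bb by auto

  define C where "C = B + (\<chi> i j. a $ i * b $ j - b $ i * a $ j)"
  have C: "C *v z = B *v z + (vdot b z *s a - vdot a z *s b)" for z
    by (simp add: C_def vec_eq_iff matrix_vector_mult_def vdot_def algebra_simps
        sum.distrib sum_subtractf sum_distrib_left)
  have "transpose C = transpose B - (\<chi> i j. a $ i * b $ j - b $ i * a $ j)"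
    by (simp add: C_def vec_eq_iff transpose_def mult.commute)
  then have "transpose C = - C" by (simp add: skew C_def)
  \<comment> \<open>As \<open>B\<close> kills \<open>a\<close> and \<open>b\<close>, applying
    \<open>B\<close> to \<open>C *v w = 0\<close> puts \<open>w\<close> into their span, so
    \<open>B *v w = 0\<close>. The added skew term then kills \<open>w\<close> too, which makes
    \<open>w\<close> orthogonal to \<open>a\<close> and \<open>b\<close> and therefore zero.\<close>
  then obtain w where w: "w \<noteq> 0" "C *v w = 0"
    using skew_odd_kernel[OF two odd] by blast
  have "B *v (C *v w) = B *v (B *v w)"
    by (simp add: C matrix_vector_right_distrib matrix_vector_mult_diff_distrib vec.scale B0)
  then have qw: "q *s w = (h * vdot a w) *s a + (k * vdot b w) *s b"
    using square[of w] w by simp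
  have "q *s (B *v w) = B *v (q *s w)" by (simp add: vec.scale)
  also have "\<dots> = 0"
    unfolding qw by (simp add: matrix_vector_right_distrib vec.scale B0)
  finally have "B *v w = 0" using q by (simp add: vec.scale_eq_0_iff)
  then have e: "vdot b w *s a - vdot a w *s b = 0" using w C[of w] by simp
  have "vdot b w = 0" using arg_cong[OF e, of "\<lambda>w. vdot w x"] x by simp
  moreover have "vdot a w = 0" using arg_cong[OF e, of "\<lambda>w. vdot w y"] y by simp
  ultimately show False using qw q w by (simp add: vec.scale_eq_0_iff)
qed

text \<open>A kernel vector \<open>v\<close> satisfies q v = h (a.v) a + k (b.v) b. The right side
  is proportional to both \<open>a\<close> and \<open>b\<close> by \<open>defect_rank_one\<close>,
  so both are multiples of \<open>v\<close>; substituting them back and cancelling a nonzero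
  coordinate of \<open>v\<close> gives \<open>q\<close>.\<close>

lemma defect_structure:
  obtains v \<alpha> \<beta> where "a = \<alpha> *s v" "b = \<beta> *s v" "B *v v = 0"
    "q = (h * \<alpha>\<^sup>2 + k * \<beta>\<^sup>2) * vdot v v"
proof -
  obtain v where v: "v \<noteq> 0" "B *v v = 0"
    using skew_odd_kernel[OF two odd skew] by blast
  obtain l where l: "v $ l \<noteq> 0" using v(1) by (auto simp: vec_eq_iff)
  have qv: "q *s v = (h * vdot a v) *s a + (k * vdot b v) *s b"
    using square[of v] v by simp
  have qvi: "q * v $ i = h * vdot a v * a $ i + k * vdot b v * b $ i" for i
    using arg_cong[OF qv, of "\<lambda>w. w $ i"] by simp
  have "q * (v $ l * a $ i) = q * (a $ l * v $ i)" for i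
  proof -
    have "q * (v $ l * a $ i) = (h * vdot a v * a $ l + k * vdot b v * b $ l) * a $ i"
      by (simp flip: qvi)
    also have "\<dots> = (h * vdot a v * a $ i + k * vdot b v * b $ i) * a $ l"
      using defect_rank_one[of i l] by (simp add: algebra_simps)
    also have "\<dots> = q * (a $ l * v $ i)"
      by (subst qvi[symmetric]) (simp add: ac_simps)
    finally show ?thesis .
  qed
  then have a: "a = (a $ l / v $ l) *s v" using q l by (simp add: vec_eq_iff field_simps)
  have "q * (v $ l * b $ i) = q * (b $ l * v $ i)" for i
  proof -
    have "q * (v $ l * b $ i) = (h * vdot a v * a $ l + k * vdot b v * b $ l) * b $ i"
      by (simp flip: qvi)
    also have "\<dots> = (h * vdot a v * a $ i + k * vdot b v * b $ i) * b $ l"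
      using defect_rank_one[of i l] by (simp add: algebra_simps)
    also have "\<dots> = q * (b $ l * v $ i)"
      by (subst qvi[symmetric]) (simp add: ac_simps)
    finally show ?thesis .
  qed
  then have b: "b = (b $ l / v $ l) *s v" using q l by (simp add: vec_eq_iff field_simps)
  define \<alpha> where "\<alpha> = a $ l / v $ l"
  define \<beta> where "\<beta> = b $ l / v $ l"
  have ab: "a = \<alpha> *s v" "b = \<beta> *s v" using a b by (simp_all add: \<alpha>_def \<beta>_def)
  have "q * v $ l = ((h * \<alpha>\<^sup>2 + k * \<beta>\<^sup>2) * vdot v v) * v $ l"
    using qvi[of l] unfolding ab by (simp add: algebra_simps power2_eq_square)
  then have "q = (h * \<alpha>\<^sup>2 + k * \<beta>\<^sup>2) * vdot v v" using l by simp
  with that ab v(2) show ?thesis by blast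
qed

corollary defect_kernel: "B *v a = 0" "B *v b = 0" "h * vdot a a + k * vdot b b = q"
  by (rule defect_structure; simp add: vec.scale algebra_simps power2_eq_square)+

end

section \<open>Anticommuting roots of minus one\<close>

text \<open>The hypothesis on indexed relations also yields injectivity: a repeated value would give
  a relation with coefficients 1 and -1. The dimension bound then applies to the image.\<close>

lemma card_le_of_independent_family:
  fixes f :: "'i \<Rightarrow> 'a::field ^ 'n"
  assumes fin: "finite I"
    and ind: "\<And>c i. (\<Sum>i\<in>I. c i *s f i) = 0 \<Longrightarrow> i \<in> I \<Longrightarrow> c i = 0"
  shows "card I \<le> CARD('n)"
proof -
  have inj: "inj_on f I"
  proof (rule inj_onI, rule ccontr)
    fix i j assume ij: "i \<in> I" "j \<in> I" "f i = f j" "i \<noteq> j"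
    have "(\<Sum>l\<in>I. (if l = i then 1 else if l = j then - 1 else 0) *s f l) =
        (\<Sum>l\<in>I. (if l = i then f i else 0) - (if l = j then f j else 0))"
      using ij by (intro sum.cong) auto
    also have "\<dots> = 0" using ij fin by (simp add: sum_subtractf)
    finally have "(if i = i then 1 else if i = j then - 1 else 0 :: 'a) = 0"
      using ind[of "\<lambda>l. if l = i then 1 else if l = j then - 1 else 0" i] ij by blast
    then show False by simp
  qed
  have "\<not> vec.dependent (f ` I)"
  proof
    assume "vec.dependent (f ` I)"
    then obtain u v where uv: "v \<in> f ` I" "u v \<noteq> 0" "(\<Sum>v\<in>f ` I. u v *s v) = 0"
      using fin by (auto simp: vec.dependent_finite)
    then have "(\<Sum>i\<in>I. u (f i) *s f i) = 0" by (simp add: sum.reindex[OF inj])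
    with ind[of "\<lambda>i. u (f i)"] uv show False by auto
  qed
  then have "card (f ` I) \<le> vec.dim (UNIV :: ('a ^ 'n) set)"
    by (intro vec.independent_card_le_dim) auto
  then show ?thesis by (simp add: card_image[OF inj] card_cart_basis)
qed

lemma card_le_of_orthogonal_family:
  fixes f :: "'i \<Rightarrow> 'a::field ^ 'n"
  assumes fin: "finite I"
    and orth: "\<And>i j. i \<in> I \<Longrightarrow> j \<in> I \<Longrightarrow> i \<noteq> j \<Longrightarrow> vdot (f i) (f j) = 0"
    and aniso: "\<And>i. i \<in> I \<Longrightarrow> vdot (f i) (f i) \<noteq> 0"
  shows "card I \<le> CARD('n)"
proof (rule card_le_of_independent_family[OF fin])
  fix c j assume z: "(\<Sum>i\<in>I. c i *s f i) = 0" and j: "j \<in> I"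
  have "0 = vdot (f j) (\<Sum>i\<in>I. c i *s f i)" by (simp add: z)
  also have "\<dots> = (\<Sum>i\<in>I. c i * vdot (f j) (f i))" by (simp add: vdot_sum_right)
  also have "\<dots> = (\<Sum>i\<in>I. if i = j then c j * vdot (f j) (f j) else 0)"
    using orth j by (intro sum.cong) auto
  finally show "c j = 0" using j fin aniso by simp
qed

section \<open>Monomials in anticommuting matrices\<close>

lemma matrix_mul_minus_left: "(- A) ** B = - (A ** (B :: 'a::ring_1 ^ 'n ^ 'm))"
  and matrix_mul_minus_right: "C ** (- B) = - (C ** (B :: 'a::ring_1 ^ 'n ^ 'm))"
  by (simp_all add: vec_eq_iff matrix_matrix_mult_def sum_negf)

lemma even_card_diff_singleton_iff:
  "finite S \<Longrightarrow> even (card (S - {i})) \<longleftrightarrow> (even (card S) \<longleftrightarrow> i \<notin> S)"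
  by (cases "i \<in> S") (simp_all only: card.remove[of S i] even_Suc Diff_empty Diff_insert0 simp_thms)

text \<open>If the cardinalities have equal parity, membership of each \<open>i\<close> agrees.
  Otherwise \<open>T\<close> is the complement of \<open>S\<close>, and the cardinalities add up to
  the even number \<open>k\<close>, a contradiction. For odd \<open>k\<close>, complementary sets
  would not be separated.\<close>

lemma subset_determined_by_parities:
  assumes k: "even k" and S: "S \<subseteq> {..<k}" and T: "T \<subseteq> {..<k::nat}"
    and par: "\<And>i. i < k \<Longrightarrow> even (card (S - {i})) = even (card (T - {i}))"
  shows "S = T"
proof -
  have fin: "finite S" "finite T" using S T finite_subset by auto
  show ?thesis
  proof (cases "even (card S) = even (card T)")
    case True
    then have "i \<in> S \<longleftrightarrow> i \<in> T" if "i < k" for i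
      using par[OF that] fin by (auto simp: even_card_diff_singleton_iff)
    then show ?thesis using S T by blast
  next
    case False
    then have "i \<in> S \<longleftrightarrow> i \<notin> T" if "i < k" for i
      using par[OF that] fin by (auto simp: even_card_diff_singleton_iff)
    then have "T = {..<k} - S" using S T by blast
    then have "card T + card S = k"
      using S fin card_mono[OF _ S] by (simp add: card_Diff_subset)
    then have "even (card T + card S)" using k by simp
    then show ?thesis using False by auto
  qed
qed

locale anticommuting_roots =
  fixes k :: nat and M :: "nat \<Rightarrow> 'a::field ^ 'n ^ 'n"
  assumes two: "(2::'a) \<noteq> 0"
    and even_k: "even k"
    and square: "\<And>i. i < k \<Longrightarrow> M i ** M i = - mat 1"
    and anticomm: "\<And>i j. i < k \<Longrightarrow> j < k \<Longrightarrow> i \<noteq> j \<Longrightarrow> M i ** M j = - (M j ** M i)"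
begin

definition monomial :: "nat list \<Rightarrow> 'a ^ 'n ^ 'n" where
  "monomial xs = foldr (\<lambda>i X. M i ** X) xs (mat 1)"

lemma monomial_simps [simp]:
  "monomial [] = mat 1" "monomial (i # xs) = M i ** monomial xs"
  by (simp_all add: monomial_def)

text \<open>Moving \<open>M i\<close> through the product costs one sign for each factor with index
  different from \<open>i\<close>; distinctness lets a cardinality count these factors.\<close>

lemma monomial_commute:
  assumes "i < k" "set xs \<subseteq> {..<k}" "distinct xs"
  shows "M i ** monomial xs =
    (if even (card (set xs - {i})) then monomial xs ** M i else - (monomial xs ** M i))"
  using assms(2,3)
proof (induction xs)
  case (Cons j xs)
  show ?case
  proof (cases "j = i")
    case True
    then have "set (j # xs) - {i} = set xs - {i}" by auto
    moreover have "M i ** (M i ** monomial xs) = (if even (card (set xs - {i}))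
        then M i ** (monomial xs ** M i) else M i ** - (monomial xs ** M i))"
      using Cons by simp
    ultimately show ?thesis
      using True by (simp add: matrix_mul_assoc matrix_mul_minus_right)
  next
    case False
    then have "set (j # xs) - {i} = insert j (set xs - {i})" by auto
    then have "even (card (set (j # xs) - {i})) \<longleftrightarrow> odd (card (set xs - {i}))"
      using Cons.prems by simp
    moreover have "M i ** monomial (j # xs) = - (M j ** (M i ** monomial xs))"
      using anticomm[of i j] False Cons.prems assms(1)
      by (simp add: matrix_mul_assoc matrix_mul_minus_left)
    moreover have "M j ** (M i ** monomial xs) = (if even (card (set xs - {i}))
        then M j ** (monomial xs ** M i) else M j ** - (monomial xs ** M i))"
      using Cons by simp
    ultimately show ?thesis
      by (simp add: matrix_mul_assoc matrix_mul_minus_right)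
  qed
qed simp

text \<open>Each factor has inverse \<open>- M j\<close>, so the monomial has a right inverse,
  namely the product of these in reverse order.\<close>

lemma monomial_nonzero:
  assumes "set xs \<subseteq> {..<k}"
  shows "\<exists>p q. monomial xs $ p $ q \<noteq> 0"
proof -
  have "\<exists>Q. monomial xs ** Q = mat 1"
    using assms
  proof (induction xs)
    case (Cons j xs)
    then obtain Q where Q: "monomial xs ** Q = mat 1" by auto
    have "monomial (j # xs) ** (Q ** (- M j)) = M j ** ((monomial xs ** Q) ** (- M j))"
      by (simp add: matrix_mul_assoc)
    also have "\<dots> = mat 1" using Cons.prems by (simp add: Q matrix_mul_minus_right square)
    finally show ?case by blast
  qed simp
  then obtain Q where Q: "monomial xs ** Q = mat 1" ..
  show ?thesis
  proof (rule ccontr)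
    assume "\<not> ?thesis"
    then have "monomial xs = 0" by (simp add: vec_eq_iff)
    moreover have "(0 :: 'a ^ 'n ^ 'n) ** Q = 0"
      by (simp add: vec_eq_iff matrix_matrix_mult_def)
    ultimately have "(mat 1 :: 'a ^ 'n ^ 'n) = 0" using Q by simp
    then have "(mat 1 :: 'a ^ 'n ^ 'n) $ p $ p = 0" for p by simp
    then show False by (simp add: mat_def)
  qed
qed

abbreviation subset_monomial :: "nat set \<Rightarrow> 'a ^ 'n ^ 'n" where
  "subset_monomial S \<equiv> monomial (sorted_list_of_set S)"

lemma subset_monomial_conj:
  assumes "i < k" "S \<subseteq> {..<k}"
  shows "M i ** subset_monomial S ** M i =
    (if even (card (S - {i})) then - subset_monomial S else subset_monomial S)"
proof -
  have "finite S" using assms(2) finite_subset by blast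
  then show ?thesis
    using monomial_commute[of i "sorted_list_of_set S"] assms square[of i]
    by (auto simp: matrix_mul_assoc[symmetric] matrix_mul_minus_left matrix_mul_minus_right)
qed

text \<open>Conjugation by \<^term>\<open>M i\<close> acts on monomials by signs; projecting a linear relation to the
  joint eigenspaces, one \<^term>\<open>i\<close> at a time, isolates a single monomial.\<close>

lemma subset_monomial_relation:
  assumes rel: "\<And>p q. (\<Sum>S\<in>Pow {..<k}. c S * subset_monomial S $ p $ q) = 0"
    and T: "T \<subseteq> {..<k}"
  shows "c T = 0"
proof -
  define ev where "ev i S = even (card (S - {i}))" for i :: nat and S
  \<comment> \<open>\<open>X m\<close> collects the subsets whose monomials have the same
    eigenvalues as that of \<open>T\<close> under the first \<open>m\<close> conjugations.\<close>
  define X where "X m = {S \<in> Pow {..<k}. \<forall>i<m. ev i S = ev i T}" for m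
  have finX: "finite (X m)" for m by (simp add: X_def)
  have proj: "\<forall>p q. (\<Sum>S\<in>X m. c S * subset_monomial S $ p $ q) = 0" if "m \<le> k" for m
    using that
  proof (induction m)
    case 0
    have "X 0 = Pow {..<k}" by (auto simp: X_def)
    then show ?case using rel by simp
  next
    case (Suc m)
    then have IH: "(\<Sum>S\<in>X m. c S * subset_monomial S $ p $ q) = 0" for p q by simp
    define e where "e S = (if ev m S then - 1 else 1 :: 'a)" for S
    show ?case
    proof (intro allI)
      fix p q
      have conj: "(M m ** subset_monomial S ** M m) $ p $ q = e S * subset_monomial S $ p $ q"
        if "S \<in> X m" for S
        using subset_monomial_conj[of m S] Suc.prems that by (simp add: X_def e_def ev_def)
      \<comment> \<open>Every entry of the conjugated sum is a linear combination of entries of the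
        original sum, which vanish by \<open>IH\<close>.\<close>
      have "(\<Sum>S\<in>X m. c S * (M m ** subset_monomial S ** M m) $ p $ q) =
          (\<Sum>S\<in>X m. \<Sum>t\<in>UNIV. \<Sum>r\<in>UNIV. M m $ p $ r * M m $ t $ q * (c S * subset_monomial S $ r $ t))"
        by (simp add: matrix_matrix_mult_def sum_distrib_left sum_distrib_right mult_ac)
      also have "\<dots> = (\<Sum>t\<in>UNIV. \<Sum>r\<in>UNIV. M m $ p $ r * M m $ t $ q *
          (\<Sum>S\<in>X m. c S * subset_monomial S $ r $ t))"
        by (subst sum.swap, rule sum.cong[OF refl], subst sum.swap) (simp add: sum_distrib_left)
      also have "\<dots> = 0" by (simp add: IH)
      finally have "(\<Sum>S\<in>X m. c S * (e S * subset_monomial S $ p $ q)) = 0"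
        using conj by (simp cong: sum.cong)
      \<comment> \<open>Adding \<open>e T\<close> times the conjugated relation doubles the terms
        with the sign of \<open>T\<close> and cancels all others.\<close>
      then have "0 = (\<Sum>S\<in>X m. c S * subset_monomial S $ p $ q) +
          e T * (\<Sum>S\<in>X m. c S * (e S * subset_monomial S $ p $ q))"
        by (simp add: IH)
      also have "\<dots> = (\<Sum>S\<in>X m. if ev m S = ev m T then 2 * (c S * subset_monomial S $ p $ q) else 0)"
        unfolding sum_distrib_left sum.distrib[symmetric]
        by (intro sum.cong) (auto simp: e_def)
      also have "\<dots> = (\<Sum>S\<in>X (Suc m). 2 * (c S * subset_monomial S $ p $ q))"
        by (subst sum.inter_filter[OF finX, symmetric], rule sum.cong) (auto simp: X_def less_Suc_eq)
      finally show "(\<Sum>S\<in>X (Suc m). c S * subset_monomial S $ p $ q) = 0"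
        using two by (simp flip: sum_distrib_left)
    qed
  qed
  have "X k = {T}"
    using subset_determined_by_parities[OF even_k _ T] T by (auto simp: X_def ev_def)
  then have "c T * subset_monomial T $ p $ q = 0" for p q
    using proj[OF order_refl, THEN spec, THEN spec, of p q] by simp
  moreover have "\<exists>p q. subset_monomial T $ p $ q \<noteq> 0"
    using T finite_subset[OF T] by (intro monomial_nonzero) auto
  ultimately show ?thesis by auto
qed

text \<open>Flattening matrices to vectors indexed by pairs turns the monomials into an independent
  family indexed by the subsets of \<open>{..<k}\<close>.\<close>

lemma two_power_le_square_dim: "2 ^ k \<le> CARD('n)\<^sup>2"
proof -
  define f :: "nat set \<Rightarrow> 'a ^ ('n \<times> 'n)" where
    "f S = (\<chi> r. subset_monomial S $ fst r $ snd r)" for S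
  have "card (Pow {..<k}) \<le> CARD('n \<times> 'n)"
  proof (rule card_le_of_independent_family)
    fix c T assume z: "(\<Sum>S\<in>Pow {..<k}. c S *s f S) = 0" and T: "T \<in> Pow {..<k}"
    have "(\<Sum>S\<in>Pow {..<k}. c S * subset_monomial S $ p $ q) = 0" for p q
      using arg_cong[OF z, of "\<lambda>v. v $ (p, q)"] by (simp add: f_def)
    then show "c T = 0" using T by (intro subset_monomial_relation[of c T]) simp_all
  qed simp
  then show ?thesis by (simp add: card_Pow power2_eq_square)
qed

end

section \<open>Orthogonal complements\<close>

text \<open>Over a general field a nonzero vector may be isotropic, so
  \<open>vdot v v \<noteq> 0\<close> is demanded; it permits the division in orthogonal
  projections.\<close>

definition orthogonal_set :: "('a::field ^ 'n) set \<Rightarrow> bool" where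
  "orthogonal_set S \<longleftrightarrow> finite S \<and> (\<forall>v\<in>S. vdot v v \<noteq> 0) \<and>
     (\<forall>v\<in>S. \<forall>w\<in>S. v \<noteq> w \<longrightarrow> vdot v w = 0)"

lemma orthogonal_set_card_le:
  fixes S :: "('a::field ^ 'n) set"
  shows "orthogonal_set S \<Longrightarrow> card S \<le> CARD('n)"
  using card_le_of_orthogonal_family[of S "\<lambda>v. v"] by (auto simp: orthogonal_set_def)

lemma vdot_nondegenerate: "(\<And>x. vdot x u = vdot x w) \<Longrightarrow> u = w"
  by (metis vdot_axis(2) vec_eq_iff)

lemma vdot_proj_orthogonal_set:
  assumes S: "orthogonal_set S" and v: "v \<in> S"
  shows "vdot v (\<Sum>u\<in>S. (vdot u x / vdot u u) *s u) = vdot v x"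
proof -
  have "vdot v (\<Sum>u\<in>S. (vdot u x / vdot u u) *s u) = (\<Sum>u\<in>S. vdot u x / vdot u u * vdot v u)"
    by (simp add: vdot_sum_right)
  also have "\<dots> = (\<Sum>u\<in>S. if u = v then vdot v x else 0)"
    using S v by (intro sum.cong) (auto simp: orthogonal_set_def)
  also have "\<dots> = vdot v x" using S v by (simp add: orthogonal_set_def)
  finally show ?thesis .
qed

text \<open>Let \<open>R\<close> be the projection along the span of \<open>S\<close>. If every
  \<open>R y\<close> were isotropic, polarization would make the form vanish on the image of
  \<open>R\<close>; by \<open>R_dot\<close> the vector \<open>R x\<close> would then be orthogonal
  to everything, hence zero. So some \<open>R y\<close> is anisotropic and extends
  \<open>S\<close>.\<close>

lemma orthogonal_set_extend:
  fixes S :: "('a::field ^ 'n) set"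
  assumes two: "(2::'a) \<noteq> 0" and S: "orthogonal_set S"
    and x: "(\<Sum>v\<in>S. (vdot v x / vdot v v) *s v) \<noteq> x"
  shows "\<exists>f. f \<notin> S \<and> orthogonal_set (insert f S)"
proof -
  define R where "R y = y - (\<Sum>v\<in>S. (vdot v y / vdot v v) *s v)" for y
  have orth: "vdot v (R y) = 0" if "v \<in> S" for v y
    using vdot_proj_orthogonal_set[OF S that] by (simp add: R_def)
  have orth': "vdot (R y) v = 0" if "v \<in> S" for v y
    using orth[OF that] by (simp add: vdot_commute)
  have R_add: "R (y + z) = R y + R z" for y z
    by (simp add: R_def add_divide_distrib vector_sadd_rdistrib sum.distrib)
  have R_dot: "vdot (R y) z = vdot (R y) (R z)" for y z
  proof -
    have "vdot (R y) (\<Sum>v\<in>S. (vdot v z / vdot v v) *s v) = 0"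
      by (simp add: vdot_sum_right orth')
    then show ?thesis by (simp add: R_def[of z])
  qed
  have "\<exists>y. vdot (R y) (R y) \<noteq> 0"
  proof (rule ccontr)
    assume "\<not> ?thesis"
    then have iso: "vdot (R y) (R y) = 0" for y by simp
    have "vdot (R y) (R z) = 0" for y z
    proof -
      have "vdot (R (y + z)) (R (y + z)) = 2 * vdot (R y) (R z)"
        using vdot_commute[of "R z" "R y"] by (simp add: R_add iso)
      then show ?thesis using iso two by simp
    qed
    then have "vdot y (R x) = vdot y 0" for y
      using R_dot[of x y] vdot_commute[of y "R x"] \<open>\<And>y z. vdot (R y) (R z) = 0\<close> by simp
    then have "R x = 0" by (rule vdot_nondegenerate)
    then show False using x by (simp add: R_def)
  qed
  then obtain y where y: "vdot (R y) (R y) \<noteq> 0" ..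
  have "R y \<notin> S" using orth[of "R y" y] y by auto
  moreover have "orthogonal_set (insert (R y) S)"
    using S y orth orth' by (auto simp: orthogonal_set_def)
  ultimately show ?thesis by blast
qed

lemma orthogonal_set_expansion:
  fixes S :: "('a::field ^ 'n) set"
  assumes "(2::'a) \<noteq> 0" "orthogonal_set S" "card S = CARD('n)"
  shows "(\<Sum>v\<in>S. (vdot v x / vdot v v) *s v) = x"
proof (rule ccontr)
  assume "\<not> ?thesis"
  then obtain f where f: "f \<notin> S" "orthogonal_set (insert f S)"
    using orthogonal_set_extend assms by blast
  have "finite S" using assms(2) by (simp add: orthogonal_set_def)
  then show False
    using orthogonal_set_card_le[OF f(2)] f(1) assms(3) by simp
qed

lemma orthogonal_set_extend_card:
  fixes S :: "('a::field ^ 'n) set"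
  assumes "(2::'a) \<noteq> 0" and S: "orthogonal_set S" and card: "card S < CARD('n)"
  shows "\<exists>f. f \<notin> S \<and> orthogonal_set (insert f S)"
proof -
  have "\<exists>x. (\<Sum>v\<in>S. (vdot v x / vdot v v) *s v) \<noteq> x"
  proof (rule ccontr)
    assume "\<not> ?thesis"
    then have x: "(\<Sum>v\<in>S. (vdot v x / vdot v v) *s v) = x" for x by simp
    have "x \<in> vec.span S" for x
      by (subst x[symmetric]) (intro vec.span_sum vec.span_scale vec.span_base)
    then have "vec.dim (UNIV :: ('a ^ 'n) set) \<le> card S"
      using S by (intro vec.dim_le_card) (auto simp: orthogonal_set_def)
    then show False using card by (simp add: card_cart_basis)
  qed
  then show ?thesis using orthogonal_set_extend assms by blast
qed

text \<open>The columns of \<open>A\<close> are orthonormal and can be completed by two orthogonal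
  anisotropic vectors \<open>f\<close> and \<open>g\<close>; the identity is Parseval's formula in
  this basis. The weights \<open>h\<close> and \<open>k\<close> are the inverse norms, as
  normalizing would require square roots.\<close>

lemma isometry_complement:
  fixes A :: "'a::field ^ 'm ^ 'n"
  assumes two: "(2::'a) \<noteq> 0" and card: "CARD('n) = CARD('m) + 2"
    and iso: "\<And>x y. vdot (A *v x) (A *v y) = vdot x y"
  obtains f g h k where "h \<noteq> 0" "k \<noteq> 0"
    "\<And>z w. vdot z w = vdot (transpose A *v z) (transpose A *v w) +
       h * (vdot f z * vdot f w) + k * (vdot g z * vdot g w)"
proof -
  define c where "c p = A *v axis p 1" for p
  have cc: "vdot (c p) (c q) = (if p = q then 1 else 0)" for p q
    by (simp add: c_def iso) (simp add: axis_def)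
  then have inj: "inj c" by (metis injI zero_neq_one)
  have S: "orthogonal_set (range c)"
    using cc by (auto simp: orthogonal_set_def)
  have cardS: "card (range c) = CARD('m)" using inj by (simp add: card_image)
  obtain f where f: "f \<notin> range c" "orthogonal_set (insert f (range c))"
    using orthogonal_set_extend_card[OF two S] card cardS by auto
  obtain g where g: "g \<notin> insert f (range c)" "orthogonal_set (insert g (insert f (range c)))"
    using orthogonal_set_extend_card[OF two f(2)] card cardS f(1) by auto
  define h where "h = inverse (vdot f f)"
  define k where "k = inverse (vdot g g)"
  have hk: "h \<noteq> 0" "k \<noteq> 0" using g by (auto simp: h_def k_def orthogonal_set_def)
  have "vdot z w = vdot (transpose A *v z) (transpose A *v w) +
       h * (vdot f z * vdot f w) + k * (vdot g z * vdot g w)" for z w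
  proof -
    have "w = (\<Sum>v\<in>insert g (insert f (range c)). (vdot v w / vdot v v) *s v)"
      using orthogonal_set_expansion[OF two g(2), of w] card cardS f g by simp
    also have "\<dots> = (k * vdot g w) *s g + ((h * vdot f w) *s f + (\<Sum>p\<in>UNIV. vdot (c p) w *s c p))"
      using f g inj by (simp add: sum.reindex cc h_def k_def field_simps)
    finally have "vdot z w = vdot z \<dots>" by (rule arg_cong)
    also have "\<dots> = (\<Sum>p\<in>UNIV. vdot (c p) z * vdot (c p) w) +
       h * (vdot f z * vdot f w) + k * (vdot g z * vdot g w)"
      by (simp add: vdot_sum_right vdot_commute[of z] mult_ac)
    also have "(\<Sum>p\<in>UNIV. vdot (c p) z * vdot (c p) w) = vdot (transpose A *v z) (transpose A *v w)"
    proof -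
      have "vdot (c p) z = (transpose A *v z) $ p" for p z
        by (simp only: c_def vdot_matrix_left vdot_axis)
      then show ?thesis by (simp only: vdot_def[of "_ *v _"])
    qed
    finally show ?thesis .
  qed
  with that hk show ?thesis by blast
qed

lemma parallel_if_minors_zero:
  fixes v w :: "'a::field ^ 'm"
  assumes "\<And>i j. v $ i * w $ j = v $ j * w $ i" "v \<noteq> 0"
  obtains c where "w = c *s v"
proof -
  obtain l where l: "v $ l \<noteq> 0" using assms(2) by (auto simp: vec_eq_iff)
  have "w = (w $ l / v $ l) *s v"
    using l assms(1)[of l] by (simp add: vec_eq_iff field_simps)
  with that show ?thesis by blast
qed

text \<open>For the form h p^2 + k r^2, two orthogonal anisotropic vectors are independent, so a
  third vector orthogonal to both is zero by nondegeneracy.\<close>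

lemma no_three_orthogonal_in_plane:
  fixes h k :: "'a::field"
  assumes "h \<noteq> 0" "k \<noteq> 0"
    and o12: "h * (p1 * p2) + k * (r1 * r2) = 0"
    and o13: "h * (p1 * p3) + k * (r1 * r3) = 0"
    and o23: "h * (p2 * p3) + k * (r2 * r3) = 0"
    and n1: "h * (p1 * p1) + k * (r1 * r1) \<noteq> 0"
    and n2: "h * (p2 * p2) + k * (r2 * r2) \<noteq> 0"
    and n3: "h * (p3 * p3) + k * (r3 * r3) \<noteq> 0"
  shows False
proof (cases "p1 * r2 = p2 * r1")
  case True
  have "p2 * (h * (p1 * p1) + k * (r1 * r1)) = p1 * (h * (p1 * p2) + k * (r1 * r2))"
    using True by algebra
  moreover have "r2 * (h * (p1 * p1) + k * (r1 * r1)) = r1 * (h * (p1 * p2) + k * (r1 * r2))"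
    using True by algebra
  ultimately show False using o12 n1 n2 by simp
next
  case False
  have "h * p3 * (p1 * r2 - p2 * r1) = 0" using o13 o23 by algebra
  moreover have "k * r3 * (p1 * r2 - p2 * r1) = 0" using o13 o23 by algebra
  ultimately show False using False assms(1,2) n3 by simp
qed

section \<open>Compositions in codimension two\<close>

text \<open>The index \<open>None\<close> stands for the extra row \<open>w\<close> and column
  \<open>u\<close> around the block \<open>B\<close>, with corner entry 0.\<close>

definition bordered :: "'a::ring_1 ^ 'm ^ 'm \<Rightarrow> 'a ^ 'm \<Rightarrow> 'a ^ 'm \<Rightarrow> 'a ^ 'm option ^ 'm option" where
  "bordered B u w = (\<chi> p q. case p of
      None \<Rightarrow> (case q of None \<Rightarrow> 0 | Some j \<Rightarrow> w $ j)
    | Some i \<Rightarrow> (case q of None \<Rightarrow> u $ i | Some j \<Rightarrow> B $ i $ j))"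

lemma sum_UNIV_option: "(\<Sum>p\<in>UNIV. f p) = f None + (\<Sum>i\<in>UNIV. f (Some (i :: 'm::finite)))"
  by (simp add: UNIV_option_conv sum.reindex)

text \<open>Block multiplication; skewness of \<open>B'\<close> turns the row w^T B' into the
  transpose of - B' w.\<close>

lemma bordered_mult:
  fixes B B' :: "'a::comm_ring_1 ^ 'm ^ 'm"
  assumes "transpose B' = - B'"
  shows "(bordered B u w ** bordered B' u' w') $ None $ None = vdot w u'"
    and "(bordered B u w ** bordered B' u' w') $ Some i $ None = (B *v u') $ i"
    and "(bordered B u w ** bordered B' u' w') $ None $ Some j = - (B' *v w) $ j"
    and "(bordered B u w ** bordered B' u' w') $ Some i $ Some j = (B ** B') $ i $ j + u $ i * w' $ j"
proof -
  have "B' $ p $ j = - B' $ j $ p" for p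
    using arg_cong[OF assms, of "\<lambda>A. A $ j $ p"] by (simp add: transpose_def)
  then have "(\<Sum>p\<in>UNIV. w $ p * B' $ p $ j) = (\<Sum>p\<in>UNIV. - (B' $ j $ p * w $ p))"
    by (intro sum.cong) (simp_all add: mult.commute)
  then show "(bordered B u w ** bordered B' u' w') $ None $ Some j = - (B' *v w) $ j"
    by (simp add: bordered_def matrix_matrix_mult_def matrix_vector_mult_def sum_UNIV_option sum_negf)
qed (simp_all add: bordered_def matrix_matrix_mult_def matrix_vector_mult_def sum_UNIV_option vdot_def)

text \<open>The matrices \<^term>\<open>B i\<close> generate a Clifford algebra up to a defect of rank at most two, measured
  by the vectors \<^term>\<open>a i\<close> and \<^term>\<open>b i\<close>.\<close>

locale clifford_defect =
  fixes B :: "nat \<Rightarrow> 'a::field ^ 'm ^ 'm" and a b :: "nat \<Rightarrow> 'a ^ 'm" and h k :: 'a and N :: nat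
  assumes two: "(2::'a) \<noteq> 0"
    and odd: "odd CARD('m)"
    and h: "h \<noteq> 0" and k: "k \<noteq> 0"
    and skew: "\<And>i. i < N \<Longrightarrow> transpose (B i) = - B i"
    and square: "\<And>i x. i < N \<Longrightarrow>
      B i *v (B i *v x) = (h * vdot (a i) x) *s a i + (k * vdot (b i) x) *s b i - x"
    and anticomm: "\<And>i j x. i < N \<Longrightarrow> j < N \<Longrightarrow> i \<noteq> j \<Longrightarrow>
      B i *v (B j *v x) + B j *v (B i *v x) =
        (h * vdot (a j) x) *s a i + (h * vdot (a i) x) *s a j +
        ((k * vdot (b j) x) *s b i + (k * vdot (b i) x) *s b j)"
begin

lemma generator_defect:
  assumes i: "i < N"
  shows "\<exists>v \<alpha> \<beta>. a i = \<alpha> *s v \<and> b i = \<beta> *s v \<and> (h * \<alpha>\<^sup>2 + k * \<beta>\<^sup>2) * vdot v v = 1"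
    and "B i *v a i = 0" "B i *v b i = 0" "h * vdot (a i) (a i) + k * vdot (b i) (b i) = 1"
proof -
  have sq: "B i *v (B i *v x) = (h * vdot (a i) x) *s a i + (k * vdot (b i) x) *s b i - 1 *s x" for x
    using square[OF i] by simp
  note prems = two odd skew[OF i] one_neq_zero h k sq
  show "\<exists>v \<alpha> \<beta>. a i = \<alpha> *s v \<and> b i = \<beta> *s v \<and> (h * \<alpha>\<^sup>2 + k * \<beta>\<^sup>2) * vdot v v = 1"
    using defect_structure[OF prems] by metis
  show "B i *v a i = 0" "B i *v b i = 0" "h * vdot (a i) (a i) + k * vdot (b i) (b i) = 1"
    using defect_kernel[OF prems] by auto
qed

text \<open>The sum \<open>B i + B j\<close> is again skew with a defect of the same shape, now with
  \<open>q = 2\<close>. Its structure minus that of the two generators leaves the mixed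
  terms.\<close>

lemma pair_defect:
  assumes i: "i < N" and j: "j < N" and ij: "i \<noteq> j"
  shows "(a i + a j) $ l * (b i + b j) $ m = (a i + a j) $ m * (b i + b j) $ l"
    and "B i *v a j + B j *v a i = 0" "B i *v b j + B j *v b i = 0"
    and "h * vdot (a i) (a j) + k * vdot (b i) (b j) = 0"
proof -
  have tr: "transpose (B i + B j) = - (B i + B j)"
  proof -
    have "transpose (B i + B j) = transpose (B i) + transpose (B j)"
      by (simp add: transpose_def vec_eq_iff)
    then show ?thesis by (simp add: skew i j)
  qed
  have sq: "(B i + B j) *v ((B i + B j) *v x) =
      (h * vdot (a i + a j) x) *s (a i + a j) + (k * vdot (b i + b j) x) *s (b i + b j) - 2 *s x" for x
  proof -
    have "(B i + B j) *v ((B i + B j) *v x) =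
        B i *v (B i *v x) + B j *v (B j *v x) + (B i *v (B j *v x) + B j *v (B i *v x))"
      by (simp add: matrix_vector_mult_add_rdistrib matrix_vector_right_distrib)
    then show ?thesis
      unfolding anticomm[OF i j ij] square[OF i] square[OF j]
      by (simp add: vec_eq_iff algebra_simps)
  qed
  note prems = two odd tr two h k sq
  show "(a i + a j) $ l * (b i + b j) $ m = (a i + a j) $ m * (b i + b j) $ l"
    by (rule defect_rank_one[OF prems])
  note kernel = defect_kernel[OF prems]
  show "B i *v a j + B j *v a i = 0" "B i *v b j + B j *v b i = 0"
    using kernel(1,2) generator_defect(2,3)[OF i] generator_defect(2,3)[OF j]
    by (simp_all add: matrix_vector_mult_add_rdistrib matrix_vector_right_distrib add.commute)
  have "2 * (h * vdot (a i) (a j) + k * vdot (b i) (b j)) +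
      (h * vdot (a i) (a i) + k * vdot (b i) (b i)) + (h * vdot (a j) (a j) + k * vdot (b j) (b j)) = 2"
    using kernel(3) vdot_commute[of "a j" "a i"] vdot_commute[of "b j" "b i"]
    by (simp add: algebra_simps)
  then have "2 * (h * vdot (a i) (a j) + k * vdot (b i) (b j)) = 0"
    unfolding generator_defect(4)[OF i] generator_defect(4)[OF j] by simp
  then show "h * vdot (a i) (a j) + k * vdot (b i) (b j) = 0"
    using two mult_eq_0_iff by blast
qed

text \<open>On a common line the relations of \<open>pair_defect\<close> and
  \<open>generator_defect\<close> say that the three coefficient pairs are orthogonal and
  anisotropic in a plane.\<close>

lemma no_common_line:
  assumes "i < N" "j < N" "l < N" "i \<noteq> j" "i \<noteq> l" "j \<noteq> l"
    and "a i = p1 *s v" "b i = r1 *s v" "a j = p2 *s v" "b j = r2 *s v" "a l = p3 *s v" "b l = r3 *s v"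
  shows False
proof -
  have o: "(h * (p1 * p2) + k * (r1 * r2)) * vdot v v = 0"
    "(h * (p1 * p3) + k * (r1 * r3)) * vdot v v = 0"
    "(h * (p2 * p3) + k * (r2 * r3)) * vdot v v = 0"
    using pair_defect(4)[of i j] pair_defect(4)[of i l] pair_defect(4)[of j l] assms by (simp_all add: algebra_simps)
  have n: "(h * (p1 * p1) + k * (r1 * r1)) * vdot v v = 1"
    "(h * (p2 * p2) + k * (r2 * r2)) * vdot v v = 1"
    "(h * (p3 * p3) + k * (r3 * r3)) * vdot v v = 1"
    using generator_defect(4)[of i] generator_defect(4)[of j] generator_defect(4)[of l] assms by (simp_all add: algebra_simps)
  have nz: "x \<noteq> 0" "vdot v v \<noteq> 0" if "x * vdot v v = 1" for x
    using that by auto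
  show False
    by (rule no_three_orthogonal_in_plane[OF h k, of p1 p2 r1 r2 p3 r3])
      (use o n nz[OF n(1)] nz[OF n(2)] nz[OF n(3)] in \<open>simp_all only: mult_eq_0_iff simp_thms\<close>)
qed

text \<open>If the pairs (\<alpha> i, \<beta> i) and (\<alpha> j, \<beta> j) were not proportional,
  \<open>v i\<close> and \<open>v j\<close> would be parallel. A third pair fails to be proportional
  to one of these two, so all three vectors would lie on one line, against
  \<open>no_common_line\<close>.\<close>

lemma common_direction:
  assumes N: "3 \<le> N"
  shows "\<exists>\<alpha> \<beta> c. \<forall>i<N. a i = \<alpha> *s c i \<and> b i = \<beta> *s c i"
proof -
  obtain v \<alpha> \<beta> where
    ab: "\<And>i. i < N \<Longrightarrow> a i = \<alpha> i *s v i" "\<And>i. i < N \<Longrightarrow> b i = \<beta> i *s v i"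
    and nz: "\<And>i. i < N \<Longrightarrow> (h * (\<alpha> i)\<^sup>2 + k * (\<beta> i)\<^sup>2) * vdot (v i) (v i) = 1"
    using generator_defect(1) by metis
  have ab0: "\<alpha> i \<noteq> 0 \<or> \<beta> i \<noteq> 0" if "i < N" for i using nz[OF that] by auto
  have v0: "v i \<noteq> 0" if "i < N" for i using nz[OF that] by auto
  have par: "\<exists>c. v j = c *s v i"
    if i: "i < N" and j: "j < N" and d: "\<alpha> i * \<beta> j \<noteq> \<alpha> j * \<beta> i" for i j
  proof -
    have ij: "i \<noteq> j" using d by auto
    have "v i $ l * v j $ m = v i $ m * v j $ l" for l m
    proof -
      \<comment> \<open>The minor of \<open>a i + a j\<close> and \<open>b i + b j\<close> factors
        into a minor of coefficients and a minor of \<open>v i\<close> and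
        \<open>v j\<close>.\<close>
      have "(\<alpha> i * \<beta> j - \<alpha> j * \<beta> i) * (v i $ l * v j $ m - v i $ m * v j $ l) = 0"
        using pair_defect(1)[OF i j ij, of l m] by (simp add: ab i j algebra_simps)
      then show ?thesis using d by simp
    qed
    then show ?thesis using parallel_if_minors_zero v0[OF i] by metis
  qed
  have "\<alpha> i * \<beta> j = \<alpha> j * \<beta> i" if i: "i < N" and j: "j < N" for i j
  proof (rule ccontr)
    assume d: "\<alpha> i * \<beta> j \<noteq> \<alpha> j * \<beta> i"
    then have ij: "i \<noteq> j" by auto
    have "card {i, j} < card {..<N}" using N by (simp add: card_insert_if)
    then obtain l where l: "l < N" "l \<noteq> i" "l \<noteq> j"
      by (metis card_mono finite.emptyI finite_insert insertCI leD lessThan_iff subsetI)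
    obtain c where c: "v j = c *s v i" using par[OF i j d] ..
    have "\<exists>e. v l = e *s v i"
    proof (cases "\<alpha> i * \<beta> l = \<alpha> l * \<beta> i")
      case True
      have "\<alpha> j * \<beta> l \<noteq> \<alpha> l * \<beta> j"
      proof
        assume e: "\<alpha> j * \<beta> l = \<alpha> l * \<beta> j"
        have "\<alpha> l * (\<alpha> i * \<beta> j - \<alpha> j * \<beta> i) = 0" using True e by algebra
        moreover have "\<beta> l * (\<alpha> i * \<beta> j - \<alpha> j * \<beta> i) = 0" using True e by algebra
        ultimately show False using d ab0[OF l(1)] by simp
      qed
      then obtain e where "v l = e *s v j" using par[OF j l(1)] by auto
      then show ?thesis using c by (auto simp: vector_smult_assoc)
    next
      case False
      then show ?thesis using par[OF i l(1)] by auto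
    qed
    then obtain e where e: "v l = e *s v i" ..
    show False
    proof (rule no_common_line[OF i j l(1) ij])
      show "a i = \<alpha> i *s v i" "b i = \<beta> i *s v i" using ab i by auto
      show "a j = (\<alpha> j * c) *s v i" "b j = (\<beta> j * c) *s v i"
        using ab j c by (auto simp: vector_smult_assoc)
      show "a l = (\<alpha> l * e) *s v i" "b l = (\<beta> l * e) *s v i"
        using ab l e by (auto simp: vector_smult_assoc)
    qed (use l in auto)
  qed
  note all_par = this
  have 0: "0 < N" using N by simp
  \<comment> \<open>The pair at index 0 serves as the common one; the factor \<open>t\<close> will
    be absorbed into the vector.\<close>
  have "\<exists>t. \<alpha> i = \<alpha> 0 * t \<and> \<beta> i = \<beta> 0 * t" if i: "i < N" for i
  proof (cases "\<alpha> 0 = 0")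
    case True
    then have b0: "\<beta> 0 \<noteq> 0" using ab0[OF 0] by simp
    then have "\<alpha> i = 0" using all_par[OF 0 i] True by simp
    then show ?thesis using True b0 by (intro exI[of _ "\<beta> i / \<beta> 0"]) simp
  next
    case False
    then show ?thesis
      using all_par[OF 0 i] by (intro exI[of _ "\<alpha> i / \<alpha> 0"]) (simp add: field_simps)
  qed
  then obtain t where t: "\<And>i. i < N \<Longrightarrow> \<alpha> i = \<alpha> 0 * t i" "\<And>i. i < N \<Longrightarrow> \<beta> i = \<beta> 0 * t i"
    by metis
  have "a i = \<alpha> 0 *s (t i *s v i) \<and> b i = \<beta> 0 *s (t i *s v i)" if "i < N" for i
    using ab[OF that] t[OF that] by (simp add: vector_smult_assoc)
  then show ?thesis
    by (intro exI[of _ "\<alpha> 0"] exI[of _ "\<beta> 0"] exI[of _ "\<lambda>i. t i *s v i"]) simp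
qed

lemma two_power_le:
  assumes N: "3 \<le> N" "even N"
  shows "2 ^ N \<le> (CARD('m) + 1)\<^sup>2"
proof -
  obtain \<alpha> \<beta> c where "\<forall>i<N. a i = \<alpha> *s c i \<and> b i = \<beta> *s c i"
    using common_direction[OF N(1)] by (elim exE)
  then have c: "a i = \<alpha> *s c i" "b i = \<beta> *s c i" if "i < N" for i
    using that by auto
  define \<kappa> where "\<kappa> = h * \<alpha>\<^sup>2 + k * \<beta>\<^sup>2"
  have cc: "\<kappa> * vdot (c i) (c i) = 1" if "i < N" for i
    using generator_defect(4)[OF that] c[OF that] by (simp add: \<kappa>_def algebra_simps power2_eq_square)
  have cd: "\<kappa> * vdot (c i) (c j) = 0" if "i < N" "j < N" "i \<noteq> j" for i j
    using pair_defect(4)[OF that] c that by (simp add: \<kappa>_def algebra_simps power2_eq_square)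
  have "\<kappa> \<noteq> 0" using cc[of 0] N by auto
  then have \<alpha>\<beta>: "\<alpha> \<noteq> 0 \<or> \<beta> \<noteq> 0" by (auto simp: \<kappa>_def)
  have Bc: "B i *v c i = 0" if "i < N" for i
    using generator_defect(2,3)[OF that] c[OF that] \<alpha>\<beta> by (auto simp: vec.scale vec.scale_eq_0_iff)
  have Bcd: "B i *v c j + B j *v c i = 0" if "i < N" "j < N" "i \<noteq> j" for i j
  proof -
    have "\<alpha> *s (B i *v c j + B j *v c i) = 0" "\<beta> *s (B i *v c j + B j *v c i) = 0"
      using pair_defect(2,3)[OF that] c that by (simp_all add: vec.scale vector_add_ldistrib)
    then show ?thesis using \<alpha>\<beta> by (auto simp: vec.scale_eq_0_iff simp del: vector_add_ldistrib)
  qed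
  have Bsq: "B i *v (B i *v x) = (\<kappa> * vdot (c i) x) *s c i - x" if "i < N" for i x
    using square[OF that, of x] c[OF that]
    by (simp add: \<kappa>_def vec_eq_iff algebra_simps power2_eq_square)
  have Banti: "B i *v (B j *v x) + B j *v (B i *v x) =
      (\<kappa> * vdot (c j) x) *s c i + (\<kappa> * vdot (c i) x) *s c j"
    if "i < N" "j < N" "i \<noteq> j" for i j x
    using anticomm[OF that, of x] c that
    by (simp add: \<kappa>_def vec_eq_iff algebra_simps power2_eq_square)
  have entry: "(X ** Y) $ p $ q = (X *v (Y *v axis q 1)) $ p" for X Y :: "'a ^ 'm ^ 'm" and p q
    by (simp add: matrix_vector_mul_assoc matrix_vector_axis)
  \<comment> \<open>Placing \<kappa> entirely in the column avoids a square root of \<kappa>. The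
    term - \<kappa> c_i c_j^T of the product cancels the defect, and the corner becomes - \<kappa>
    c_i.c_j, which is -1 for i = j and 0 otherwise.\<close>
  define M where "M i = bordered (B i) (- (\<kappa> *s c i)) (c i)" for i
  have mult: "(M i ** M j) $ None $ None = - (\<kappa> * vdot (c i) (c j))"
    "(M i ** M j) $ Some p $ None = - (\<kappa> * (B i *v c j) $ p)"
    "(M i ** M j) $ None $ Some q = - (B j *v c i) $ q"
    "(M i ** M j) $ Some p $ Some q = (B i *v (B j *v axis q 1)) $ p - \<kappa> * c i $ p * c j $ q"
    if "j < N" for i j p q
    using bordered_mult[OF skew[OF that]]
    by (simp_all add: M_def entry vec.neg vec.scale)
  interpret anticommuting_roots N M
  proof
    show "M i ** M i = - mat 1" if "i < N" for i
      using cc[OF that] Bc[OF that]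
      by (simp add: vec_eq_iff split_option_all mult[OF that] Bsq[OF that])
        (auto simp: mat_def axis_def)
    show "M i ** M j = - (M j ** M i)" if ij: "i < N" "j < N" "i \<noteq> j" for i j
    proof -
      have 1: "(B i *v c j) $ p = - (B j *v c i) $ p" for p
        using arg_cong[OF Bcd[OF ij], of "\<lambda>v. v $ p"] by (simp add: eq_neg_iff_add_eq_0)
      have 2: "(B i *v (B j *v axis q 1)) $ p =
          \<kappa> * c j $ q * c i $ p + \<kappa> * c i $ q * c j $ p - (B j *v (B i *v axis q 1)) $ p" for p q
        using arg_cong[OF Banti[OF ij, of "axis q 1"], of "\<lambda>v. v $ p"] by (simp add: algebra_simps)
      show ?thesis
        using cd[OF ij] cd[OF ij(2,1)] ij \<open>\<kappa> \<noteq> 0\<close>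
        by (simp add: vec_eq_iff split_option_all mult 1 2)
    qed
  qed (use two N in auto)
  show ?thesis using two_power_le_square_dim by (simp add: card_UNIV_option)
qed

end

text \<open>The hypotheses say that \<open>\<Sum>\<^sub>i x\<^sub>i A\<^sub>i y\<close> is a composition of type \<open>[N + 1, m, m + 2]\<close>.\<close>

theorem codim_two_composition_bound:
  fixes A :: "nat \<Rightarrow> 'a::field ^ 'm ^ 'n"
  assumes two: "(2::'a) \<noteq> 0" and odd: "odd CARD('m)" and card: "CARD('n) = CARD('m) + 2"
    and N: "3 \<le> N" "even N"
    and norm: "\<And>i x y. i \<le> N \<Longrightarrow> vdot (A i *v x) (A i *v y) = vdot x y"
    and orth: "\<And>i j x y. i \<le> N \<Longrightarrow> j \<le> N \<Longrightarrow> i \<noteq> j \<Longrightarrow>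
      vdot (A i *v x) (A j *v y) + vdot (A j *v x) (A i *v y) = 0"
  shows "2 ^ N \<le> (CARD('m) + 1)\<^sup>2"
proof -
  obtain f g h k where hk: "h \<noteq> 0" "k \<noteq> 0" and
    split: "\<And>z w. vdot z w = vdot (transpose (A N) *v z) (transpose (A N) *v w) +
       h * (vdot f z * vdot f w) + k * (vdot g z * vdot g w)"
    using isometry_complement[OF two card norm[OF order_refl]] by metis
  \<comment> \<open>\<open>B i\<close> is the compression of \<open>A i\<close> to the image of
    \<open>A N\<close>; \<open>a i\<close> and \<open>b i\<close> record the components along
    \<open>f\<close> and \<open>g\<close> that are lost.\<close>
  define B where "B i = transpose (A N) ** A i" for i
  define a where "a i = transpose (A i) *v f" for i
  define b where "b i = transpose (A i) *v g" for i
  have B: "B i *v x = transpose (A N) *v (A i *v x)" for i x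
    by (simp only: B_def matrix_vector_mul_assoc)
  have Bx: "vdot (B i *v x) y = vdot (A i *v x) (A N *v y)" for i x y
    by (simp only: B vdot_matrix_left transpose_transpose)
  have skew: "vdot (B i *v x) y = - vdot x (B i *v y)" if "i < N" for i x y
  proof -
    have "vdot (A i *v x) (A N *v y) + vdot (A N *v x) (A i *v y) = 0"
      using orth[of i N] that by simp
    then show ?thesis
      using vdot_commute[of x "B i *v y"] vdot_commute[of "A N *v x" "A i *v y"]
      by (simp add: Bx eq_neg_iff_add_eq_0)
  qed
  have fa: "vdot f (A i *v x) = vdot (a i) x" "vdot g (A i *v x) = vdot (b i) x" for i x
    unfolding a_def b_def by (simp_all only: vdot_matrix_left transpose_transpose)
  \<comment> \<open>Splitting the product of \<open>A i *v x\<close> and \<open>A j *v y\<close>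
    along the image of \<open>A N\<close> and its complement, then moving \<open>B i\<close> across
    by skewness, reduces the Clifford relations to \<open>norm\<close> and
    \<open>orth\<close>.\<close>
  have BB: "vdot x (B i *v (B j *v y)) =
      h * (vdot (a i) x * vdot (a j) y) + k * (vdot (b i) x * vdot (b j) y) - vdot (A i *v x) (A j *v y)"
    if "i < N" for i j x y
  proof -
    have "vdot (A i *v x) (A j *v y) = vdot (B i *v x) (B j *v y) +
        h * (vdot (a i) x * vdot (a j) y) + k * (vdot (b i) x * vdot (b j) y)"
      unfolding B fa[symmetric] by (rule split)
    then show ?thesis using skew[OF that, of x "B j *v y"] by simp
  qed
  have "clifford_defect B a b h k N"
  proof
    show "transpose (B i) = - B i" if "i < N" for i
    proof -
      have "transpose (B i) $ p $ q = (- B i) $ p $ q" for p q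
        using skew[OF that, of "axis p 1" "axis q 1"]
        by (simp add: matrix_vector_axis transpose_def)
      then show ?thesis by (simp add: vec_eq_iff)
    qed
    show "B i *v (B i *v x) = (h * vdot (a i) x) *s a i + (k * vdot (b i) x) *s b i - x"
      if "i < N" for i x
      using that
      by (intro vdot_nondegenerate)
        (simp add: BB norm vdot_commute[of _ "a i"] vdot_commute[of _ "b i"] algebra_simps)
    show "B i *v (B j *v x) + B j *v (B i *v x) =
        (h * vdot (a j) x) *s a i + (h * vdot (a i) x) *s a j +
        ((k * vdot (b j) x) *s b i + (k * vdot (b i) x) *s b j)"
      if ij: "i < N" "j < N" "i \<noteq> j" for i j x
    proof (rule vdot_nondegenerate)
      fix y
      have "vdot (A i *v y) (A j *v x) + vdot (A j *v y) (A i *v x) = 0"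
        using orth ij by simp
      then have "vdot y (B i *v (B j *v x)) + vdot y (B j *v (B i *v x)) =
          h * (vdot (a i) y * vdot (a j) x) + k * (vdot (b i) y * vdot (b j) x) +
          (h * (vdot (a j) y * vdot (a i) x) + k * (vdot (b j) y * vdot (b i) x))"
        unfolding BB[OF ij(1)] BB[OF ij(2)] by algebra
      then show "vdot y (B i *v (B j *v x) + B j *v (B i *v x)) =
          vdot y ((h * vdot (a j) x) *s a i + (h * vdot (a i) x) *s a j +
            ((k * vdot (b j) x) *s b i + (k * vdot (b i) x) *s b j))"
        using vdot_commute[of y "a i"] vdot_commute[of y "a j"]
          vdot_commute[of y "b i"] vdot_commute[of y "b j"]
        by (simp add: algebra_simps)
    qed
  qed (use two odd hk in auto)
  then show ?thesis using clifford_defect.two_power_le N by blast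
qed

section \<open>Evaluation of sums-of-squares formulas\<close>

definition monom_eval :: "('v \<Rightarrow> 'a::comm_ring_1) \<Rightarrow> ('v \<Rightarrow>\<^sub>0 nat) \<Rightarrow> 'a" where
  "monom_eval \<rho> m = (\<Prod>v\<in>Poly_Mapping.keys m. \<rho> v ^ Poly_Mapping.lookup m v)"

lemma monom_eval_superset:
  assumes "finite V" "Poly_Mapping.keys m \<subseteq> V"
  shows "monom_eval \<rho> m = (\<Prod>v\<in>V. \<rho> v ^ Poly_Mapping.lookup m v)"
  unfolding monom_eval_def using assms
  by (intro prod.mono_neutral_left) (auto simp: in_keys_iff)

lemma monom_eval_add: "monom_eval \<rho> (m + n) = monom_eval \<rho> m * monom_eval \<rho> n"
proof -
  let ?V = "Poly_Mapping.keys m \<union> Poly_Mapping.keys n"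
  have "monom_eval \<rho> (m + n) = (\<Prod>v\<in>?V. \<rho> v ^ Poly_Mapping.lookup (m + n) v)"
    by (rule monom_eval_superset) (use keys_add[of m n] in auto)
  also have "\<dots> = monom_eval \<rho> m * monom_eval \<rho> n"
    by (simp add: monom_eval_superset[of ?V] lookup_add power_add prod.distrib)
  finally show ?thesis .
qed

definition poly_eval :: "('v \<Rightarrow> 'a::comm_ring_1) \<Rightarrow> (('v \<Rightarrow>\<^sub>0 nat) \<Rightarrow>\<^sub>0 'a) \<Rightarrow> 'a" where
  "poly_eval \<rho> p = (\<Sum>m\<in>Poly_Mapping.keys p. Poly_Mapping.lookup p m * monom_eval \<rho> m)"

lemma poly_eval_superset:
  assumes "finite V" "Poly_Mapping.keys p \<subseteq> V"
  shows "poly_eval \<rho> p = (\<Sum>m\<in>V. Poly_Mapping.lookup p m * monom_eval \<rho> m)"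
  unfolding poly_eval_def using assms
  by (intro sum.mono_neutral_left) (auto simp: in_keys_iff)

lemma poly_eval_single [simp]: "poly_eval \<rho> (Poly_Mapping.single m c) = c * monom_eval \<rho> m"
  by (subst poly_eval_superset[of "{m}"]) auto

lemma poly_eval_add: "poly_eval \<rho> (p + q) = poly_eval \<rho> p + poly_eval \<rho> q"
proof -
  let ?V = "Poly_Mapping.keys p \<union> Poly_Mapping.keys q"
  have "poly_eval \<rho> (p + q) = (\<Sum>m\<in>?V. Poly_Mapping.lookup (p + q) m * monom_eval \<rho> m)"
    by (rule poly_eval_superset) (use keys_add[of p q] in auto)
  also have "\<dots> = poly_eval \<rho> p + poly_eval \<rho> q"
    by (simp add: poly_eval_superset[of ?V] lookup_add distrib_right sum.distrib)
  finally show ?thesis .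
qed

lemma poly_eval_zero [simp]: "poly_eval \<rho> 0 = 0"
  by (simp add: poly_eval_def)

lemma poly_eval_sum: "poly_eval \<rho> (\<Sum>i\<in>I. p i) = (\<Sum>i\<in>I. poly_eval \<rho> (p i))"
  by (induction I rule: infinite_finite_induct) (simp_all add: poly_eval_add)

lemma poly_mapping_sum_single:
  "p = (\<Sum>m\<in>Poly_Mapping.keys p. Poly_Mapping.single m (Poly_Mapping.lookup p m))"
proof (rule poly_mapping_eqI)
  fix m
  show "Poly_Mapping.lookup p m =
      Poly_Mapping.lookup (\<Sum>m\<in>Poly_Mapping.keys p. Poly_Mapping.single m (Poly_Mapping.lookup p m)) m"
    by (simp add: lookup_sum lookup_single when_def in_keys_iff)
qed

text \<open>Writing both factors as sums of single terms reduces the convolution product to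
  \<open>monom_eval_add\<close>.\<close>

lemma poly_eval_mult: "poly_eval \<rho> (p * q) = poly_eval \<rho> p * poly_eval \<rho> q"
proof -
  have "poly_eval \<rho> (p * q) = poly_eval \<rho>
      ((\<Sum>m\<in>Poly_Mapping.keys p. Poly_Mapping.single m (Poly_Mapping.lookup p m)) *
       (\<Sum>n\<in>Poly_Mapping.keys q. Poly_Mapping.single n (Poly_Mapping.lookup q n)))"
    by (simp flip: poly_mapping_sum_single)
  also have "\<dots> = poly_eval \<rho> p * poly_eval \<rho> q"
    unfolding poly_eval_def[of _ p] poly_eval_def[of _ q]
    by (simp add: sum_product mult_single poly_eval_sum monom_eval_add mult_ac)
  finally show ?thesis .
qed

lemma poly_eval_power2: "poly_eval \<rho> (p\<^sup>2) = (poly_eval \<rho> p)\<^sup>2"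
  by (simp add: power2_eq_square poly_eval_mult)

lemma poly_eval_pconst [simp]: "poly_eval \<rho> (pconst c) = c"
  by (simp add: pconst_def monom_eval_def)

lemma poly_eval_pvar [simp]: "poly_eval \<rho> (pvar v) = \<rho> v"
  by (simp add: pvar_def monom_eval_def)

lemma sos_formula_eval:
  fixes z :: "nat \<Rightarrow> 'a::field sos_poly"
  assumes "sos_formula r s n z"
  obtains c :: "nat \<Rightarrow> nat \<Rightarrow> nat \<Rightarrow> 'a" where "\<And>X Y. (\<Sum>j = 1..r. (X j)\<^sup>2) * (\<Sum>k = 1..s. (Y k)\<^sup>2) =
    (\<Sum>i = 1..n. (\<Sum>j = 1..r. \<Sum>k = 1..s. c i j k * (X j * Y k))\<^sup>2)"
proof -
  have "\<forall>i\<in>{1..n}. \<exists>c. z i = (\<Sum>j = 1..r. \<Sum>k = 1..s. pconst (c j k) * (pvar (VX j) * pvar (VY k)))"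
    using assms unfolding sos_formula_def bilinear_form_def by (rule conjunct1)
  from bchoice[OF this] obtain c where c: "\<forall>i\<in>{1..n}.
      z i = (\<Sum>j = 1..r. \<Sum>k = 1..s. pconst (c i j k) * (pvar (VX j) * pvar (VY k)))"
    by (elim exE)
  have "(\<Sum>j = 1..r. (X j)\<^sup>2) * (\<Sum>k = 1..s. (Y k)\<^sup>2) =
      (\<Sum>i = 1..n. (\<Sum>j = 1..r. \<Sum>k = 1..s. c i j k * (X j * Y k))\<^sup>2)" for X Y
  proof -
    define \<rho> where "\<rho> v = (case v of VX j \<Rightarrow> X j | VY k \<Rightarrow> Y k)" for v
    have \<rho>: "\<rho> (VX j) = X j" "\<rho> (VY k) = Y k" for j k by (simp_all add: \<rho>_def)
    have "poly_eval \<rho> ((\<Sum>j = 1..r. (pvar (VX j))\<^sup>2) * (\<Sum>k = 1..s. (pvar (VY k))\<^sup>2)) =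
        poly_eval \<rho> (\<Sum>i = 1..n. (z i)\<^sup>2)"
      using assms by (simp add: sos_formula_def)
    then show ?thesis
      by (simp add: poly_eval_mult poly_eval_sum poly_eval_power2 c \<rho>)
  qed
  with that show ?thesis by blast
qed

section \<open>From a formula to a family of matrices\<close>

text \<open>Unit vectors substituted for the first variables give norm preservation, sums of two
  unit vectors give orthogonality, and polarization in the second variables yields the bilinear
  identities.\<close>

lemma sos_formula_matrices:
  fixes z :: "nat \<Rightarrow> 'a::field sos_poly"
  assumes two: "(2::'a) \<noteq> 0" and sos: "sos_formula (Suc N) CARD('m) CARD('n) z"
  obtains A :: "nat \<Rightarrow> 'a ^ 'm ^ 'n"
  where "\<And>i x y. i \<le> N \<Longrightarrow> vdot (A i *v x) (A i *v y) = vdot x y"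
    and "\<And>i j x y. i \<le> N \<Longrightarrow> j \<le> N \<Longrightarrow> i \<noteq> j \<Longrightarrow>
      vdot (A i *v x) (A j *v y) + vdot (A j *v x) (A i *v y) = 0"
proof -
  obtain c :: "nat \<Rightarrow> nat \<Rightarrow> nat \<Rightarrow> 'a" where c: "\<And>X Y. (\<Sum>j = 1..Suc N. (X j)\<^sup>2) * (\<Sum>k = 1..CARD('m). (Y k)\<^sup>2) =
      (\<Sum>i = 1..CARD('n). (\<Sum>j = 1..Suc N. \<Sum>k = 1..CARD('m). c i j k * (X j * Y k))\<^sup>2)"
    using sos_formula_eval[OF sos] by blast
  obtain em :: "nat \<Rightarrow> 'm" where em: "bij_betw em {1..CARD('m)} UNIV"
    using ex_bij_betw_nat_finite_1[of "UNIV :: 'm set"] by auto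
  obtain en :: "nat \<Rightarrow> 'n" where en: "bij_betw en {1..CARD('n)} UNIV"
    using ex_bij_betw_nat_finite_1[of "UNIV :: 'n set"] by auto
  \<comment> \<open>\<open>dm\<close> and \<open>dn\<close> number the coordinates from 1 as in the
    formula, whereas the matrices are numbered from 0; hence \<open>Suc j\<close> in
    \<open>A\<close>.\<close>
  define dm where "dm = inv_into {1..CARD('m)} em"
  define dn where "dn = inv_into {1..CARD('n)} en"
  have dm: "dm (em k) = k" if "k \<in> {1..CARD('m)}" for k
    using that em by (simp add: dm_def bij_betw_def)
  have dn: "dn (en k) = k" if "k \<in> {1..CARD('n)}" for k
    using that en by (simp add: dn_def bij_betw_def)
  define A :: "nat \<Rightarrow> 'a ^ 'm ^ 'n" where "A j = (\<chi> p q. c (dn p) (Suc j) (dm q))" for j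
  define L where "L X y = (\<Sum>j\<le>N. X j *s (A j *v y))" for X :: "nat \<Rightarrow> 'a" and y
  have norm: "vdot (L X y) (L X y) = (\<Sum>j\<le>N. (X j)\<^sup>2) * vdot y y" for X y
  proof -
    have shift: "(\<Sum>j = 1..Suc N. g j) = (\<Sum>j\<le>N. g (Suc j))" for g :: "nat \<Rightarrow> 'a"
      by (simp only: One_nat_def sum.shift_bounds_cl_Suc_ivl atLeast0AtMost)
    have "vdot (L X y) (L X y) = (\<Sum>i = 1..CARD('n). (L X y $ en i)\<^sup>2)"
      unfolding vdot_def using sum.reindex_bij_betw[OF en, of "\<lambda>p. L X y $ p * L X y $ p"]
      by (simp add: power2_eq_square)
    also have "\<dots> = (\<Sum>i = 1..CARD('n). (\<Sum>j = 1..Suc N. \<Sum>k = 1..CARD('m).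
        c i j k * (X (j - 1) * y $ em k))\<^sup>2)"
    proof (rule sum.cong[OF refl])
      fix i assume i: "i \<in> {1..CARD('n)}"
      have "(A j *v y) $ en i = (\<Sum>k = 1..CARD('m). c i (Suc j) k * y $ em k)" for j
      proof -
        have "(A j *v y) $ en i = (\<Sum>k = 1..CARD('m). c (dn (en i)) (Suc j) (dm (em k)) * y $ em k)"
          using sum.reindex_bij_betw[OF em, of "\<lambda>q. c (dn (en i)) (Suc j) (dm q) * y $ q"]
          by (simp add: A_def matrix_vector_mult_def)
        then show ?thesis by (simp add: dn[OF i] dm)
      qed
      then show "(L X y $ en i)\<^sup>2 = (\<Sum>j = 1..Suc N. \<Sum>k = 1..CARD('m).
          c i j k * (X (j - 1) * y $ em k))\<^sup>2"
        unfolding shift by (simp add: L_def sum_distrib_left mult_ac)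
    qed
    also have "\<dots> = (\<Sum>j = 1..Suc N. (X (j - 1))\<^sup>2) * (\<Sum>k = 1..CARD('m). (y $ em k)\<^sup>2)"
      by (rule c[symmetric])
    also have "(\<Sum>k = 1..CARD('m). (y $ em k)\<^sup>2) = vdot y y"
      unfolding vdot_def using sum.reindex_bij_betw[OF em, of "\<lambda>q. y $ q * y $ q"]
      by (simp add: power2_eq_square)
    finally show ?thesis unfolding shift by simp
  qed
  have L1: "L (\<lambda>l. if l = i then 1 else 0) y = A i *v y" if "i \<le> N" for i y
    using that by (simp add: L_def if_distrib[of "\<lambda>t. t *s _"] cong: if_cong)
  have iso: "vdot (A i *v x) (A i *v y) = vdot x y" if i: "i \<le> N" for i x y
  proof -
    have "(\<Sum>j\<le>N. (if j = i then 1 else 0 :: 'a)\<^sup>2) = 1"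
      using i by (simp add: if_distrib[of "\<lambda>t. t\<^sup>2"] cong: if_cong)
    then have n: "vdot (A i *v x) (A i *v x) = vdot x x" for x
      using norm[of "\<lambda>l. if l = i then 1 else 0" x] i
      by (simp add: L1)
    have "2 * vdot (A i *v x) (A i *v y) = 2 * vdot x y"
      using n[of "x + y"] n[of x] n[of y] vdot_commute[of y x] vdot_commute[of "A i *v y" "A i *v x"]
      by (simp add: matrix_vector_right_distrib)
    then show ?thesis using two by simp
  qed
  moreover have "vdot (A i *v x) (A j *v y) + vdot (A j *v x) (A i *v y) = 0"
    if i: "i \<le> N" and j: "j \<le> N" and ij: "i \<noteq> j" for i j x y
  proof -
    have "vdot (A i *v x) (A j *v x) = 0" for x
    proof -
      \<comment> \<open>For this sum of two distinct unit vectors the sum of squares is 2, which the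
        two norm terms use up; twice the mixed term is left and must vanish.\<close>
      define X :: "nat \<Rightarrow> 'a" where "X l = (if l = i then 1 else 0) + (if l = j then 1 else 0)" for l
      have "L X x = A i *v x + A j *v x"
        by (simp only: L1[OF i, symmetric] L1[OF j, symmetric])
          (simp add: L_def X_def vector_sadd_rdistrib sum.distrib)
      moreover have "(\<Sum>l\<le>N. (X l)\<^sup>2) = (\<Sum>l\<le>N. (if l = i then 1 else 0) + (if l = j then 1 else 0))"
        using ij by (intro sum.cong) (auto simp: X_def)
      moreover have "\<dots> = 2" using i j by (simp add: sum.distrib)
      ultimately have "2 * vdot (A i *v x) (A j *v x) = 0"
        using norm[of X x] iso[OF i, of x x] iso[OF j, of x x] vdot_commute[of "A j *v x" "A i *v x"]
        by simp
      then show ?thesis using two by simp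
    qed
    then have "vdot (A i *v (x + y)) (A j *v (x + y)) = 0"
      "vdot (A i *v x) (A j *v x) = 0" "vdot (A i *v y) (A j *v y) = 0" by blast+
    then show ?thesis
      using vdot_commute[of "A j *v x" "A i *v y"]
      by (simp add: matrix_vector_right_distrib add.commute)
  qed
  ultimately show ?thesis by (rule that)
qed

theorem mainTheorem2:
  assumes "CHAR('a::field) \<noteq> 2"
  shows "\<not> (\<exists>z :: nat \<Rightarrow> 'a sos_poly. sos_formula 11 15 17 z)"
proof
  assume "\<exists>z :: nat \<Rightarrow> 'a sos_poly. sos_formula 11 15 17 z"
  then obtain z :: "nat \<Rightarrow> 'a sos_poly" where z: "sos_formula 11 15 17 z" ..
  have two: "(2::'a) \<noteq> 0"
  proof
    assume "(2::'a) = 0"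
    then have "CHAR('a) dvd 2"
      using of_nat_eq_0_iff_char_dvd[where 'a = 'a, of 2] by simp
    then have "CHAR('a) \<le> 2" "CHAR('a) \<noteq> 0"
      by (simp add: dvd_imp_le) (metis \<open>CHAR('a) dvd 2\<close> dvd_0_left_iff zero_neq_numeral)
    then show False using assms CHAR_not_1[where 'a = 'a] by simp
  qed
  obtain A :: "nat \<Rightarrow> 'a ^ 15 ^ 17"
    where "\<And>i x y. i \<le> 10 \<Longrightarrow> vdot (A i *v x) (A i *v y) = vdot x y"
    and "\<And>i j x y. i \<le> 10 \<Longrightarrow> j \<le> 10 \<Longrightarrow> i \<noteq> j \<Longrightarrow>
      vdot (A i *v x) (A j *v y) + vdot (A j *v x) (A i *v y) = 0"
    using sos_formula_matrices[where 'm = 15 and 'n = 17, OF two, of 10 z] z by auto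
  \<comment> \<open>With \<open>N = 10\<close> and size 15 the bound reads 1024 \<le> 256.\<close>
  then have "2 ^ 10 \<le> (CARD(15) + 1)\<^sup>2"
    by (intro codim_two_composition_bound[OF two]) auto
  then show False by simp
qed

end
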